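(* Let $d\ge1$ and $L\ge2$ be integers, $\Phi\in\mathbb{R}^{d\times d}$, and $W_1,\dots,W_L\in\mathbb{R}^{d\times d}$, with $\mathcal{R}=\tfrac12\|W_{L:1}-\Phi\|_F^2$. Suppose $\|W_l\|_2\le\alpha$ for $l=1,\dots,L-1$ and $\|W_L\|_2\le\beta$, where $\alpha,\beta\ge0$ and, for some $\phi>0$, $1\le\alpha^{2(L-1)}<L\phi^2$ and $\alpha^{2(L-1)}\beta^2<2\phi^2$. Then $$\|\nabla_l\mathcal{R}\|_F^2\le4\phi^2\mathcal{R}\quad(l=1,\dots,L-1),\qquad\|\nabla_L\mathcal{R}\|_F^2\le2L\phi^2\mathcal{R}.$$
   Context: For $l_2\ge l_1$ write $W_{l_2:l_1}=W_{l_2}\cdots W_{l_1}$, empty products being the identity $I$. $\nabla_l\mathcal{R}=W_{L:l+1}^\intercal(W_{L:1}-\Phi)W_{l-1:1}^\intercal$ is the gradient of $\mathcal{R}(W_1,\dots,W_L)=\tfrac12\|W_L\cdots W_1-\Phi\|_F^2$ with respect to $W_l$. $\|\cdot\|_2$ is the spectral norm and $\|\cdot\|_F$ the Frobenius norm. *)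

theory Defs
  imports "HOL-Analysis.Analysis"
begin

text \<open>Ordered product W_hi * W_(hi-1) * ... * W_lo; identity if hi < lo.\<close>
definition mprod :: "(nat \<Rightarrow> real^'n^'n) \<Rightarrow> nat \<Rightarrow> nat \<Rightarrow> real^'n^'n" where
  "mprod W hi lo = foldr (\<lambda>l M. W l ** M) (rev [lo..<Suc hi]) (mat 1)"

text \<open>Frobenius norm.\<close>
definition frob_norm :: "real^'n^'m \<Rightarrow> real" where
  "frob_norm A = sqrt (\<Sum>i\<in>UNIV. \<Sum>j\<in>UNIV. (A $ i $ j)^2)"

text \<open>Spectral norm (operator norm induced by the Euclidean norm).\<close>
definition spec_norm :: "real^'n^'m \<Rightarrow> real" where
  "spec_norm A = onorm (\<lambda>x. A *v x)"

definition risk :: "(nat \<Rightarrow> real^'n^'n) \<Rightarrow> real^'n^'n \<Rightarrow> nat \<Rightarrow> real" where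
  "risk W Phi L = (1/2) * (frob_norm (mprod W L 1 - Phi))^2"

definition grad :: "(nat \<Rightarrow> real^'n^'n) \<Rightarrow> real^'n^'n \<Rightarrow> nat \<Rightarrow> nat \<Rightarrow> real^'n^'n" where
  "grad W Phi L l = transpose (mprod W L (l+1)) ** (mprod W L 1 - Phi) ** transpose (mprod W (l-1) 1)"

end

theory Submission
  imports Defs
begin

text \<open>Since \<open>\<nabla>\<^sub>l\<R> = W\<^sub>L\<^sub>:\<^sub>l\<^sub>+\<^sub>1\<^sup>T (W\<^sub>L\<^sub>:\<^sub>1 - \<Phi>) W\<^sub>l\<^sub>-\<^sub>1\<^sub>:\<^sub>1\<^sup>T\<close>, the bound
  \<open>\<parallel>A E B\<parallel>\<^sub>F \<le> \<parallel>A\<parallel>\<^sub>2 \<parallel>E\<parallel>\<^sub>F \<parallel>B\<parallel>\<^sub>2\<close>, together with submultiplicativity and transposition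
  invariance of the spectral norm, gives \<open>\<parallel>\<nabla>\<^sub>l\<R>\<parallel>\<^sub>F\<^sup>2 \<le> 2 \<beta>\<^sup>2 \<alpha>\<^bsup>2(L-2)\<^esup> \<R>\<close> for \<open>l < L\<close>
  and \<open>\<parallel>\<nabla>\<^sub>L\<R>\<parallel>\<^sub>F\<^sup>2 \<le> 2 \<alpha>\<^bsup>2(L-1)\<^esup> \<R>\<close>. As \<open>\<alpha>\<^bsup>2(L-1)\<^esup> \<ge> 1\<close> forces \<open>\<alpha> \<ge> 1\<close>, both
  are controlled by the hypotheses on \<open>\<alpha>\<^bsup>2(L-1)\<^esup>\<close>.\<close>

lemma frob_norm_eq_norm: "frob_norm M = norm M"
  by (simp add: frob_norm_def norm_vec_def L2_set_def sum_nonneg)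

lemma spec_norm_nonneg: "0 \<le> spec_norm A"
  unfolding spec_norm_def by (rule onorm_pos_le[OF matrix_vector_mul_bounded_linear])

lemma norm_matrix_vector_mult_le: "norm (A *v x) \<le> spec_norm A * norm x"
  unfolding spec_norm_def by (rule onorm[OF matrix_vector_mul_bounded_linear])

lemma spec_norm_leI: "(\<And>x. norm (A *v x) \<le> c * norm x) \<Longrightarrow> spec_norm A \<le> c"
  unfolding spec_norm_def by (rule onorm_le)

lemma spec_norm_mat_1_le: "spec_norm (mat 1) \<le> 1"
  by (rule spec_norm_leI) simp

lemma spec_norm_matrix_mult_le: "spec_norm (A ** B) \<le> spec_norm A * spec_norm B"
proof (rule spec_norm_leI)
  fix x
  have "norm ((A ** B) *v x) = norm (A *v (B *v x))"
    by (simp add: matrix_vector_mul_assoc)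
  also have "\<dots> \<le> spec_norm A * (spec_norm B * norm x)"
    using norm_matrix_vector_mult_le[of A] norm_matrix_vector_mult_le[of B]
    by (meson order_trans mult_left_mono spec_norm_nonneg)
  finally show "norm ((A ** B) *v x) \<le> spec_norm A * spec_norm B * norm x"
    by (simp add: mult.assoc)
qed

lemma spec_norm_transpose_le: "spec_norm (transpose A) \<le> spec_norm A"
proof (rule spec_norm_leI)
  fix y
  let ?z = "transpose A *v y"
  have "norm ?z ^ 2 = inner y (A *v ?z)"
    by (simp add: power2_norm_eq_inner dot_lmul_matrix)
  also have "\<dots> \<le> norm y * norm (A *v ?z)"
    by (rule norm_cauchy_schwarz)
  also have "\<dots> \<le> norm y * (spec_norm A * norm ?z)"
    by (simp add: mult_left_mono norm_matrix_vector_mult_le)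
  finally have "norm ?z * norm ?z \<le> (spec_norm A * norm y) * norm ?z"
    by (simp add: power2_eq_square algebra_simps)
  then show "norm ?z \<le> spec_norm A * norm y"
    by (cases "norm ?z = 0") (auto simp: spec_norm_nonneg)
qed

lemma spec_norm_transpose: "spec_norm (transpose A) = spec_norm A"
  using spec_norm_transpose_le[of A] spec_norm_transpose_le[of "transpose A"] by simp

lemma norm_transpose: "norm (transpose (M::real^'n^'m)) = norm M"
proof -
  have "(\<Sum>i\<in>UNIV. \<Sum>j\<in>UNIV. (M $ j $ i)^2) = (\<Sum>i\<in>UNIV. \<Sum>j\<in>UNIV. (M $ i $ j)^2)"
    by (rule sum.swap)
  then show ?thesis
    by (simp add: frob_norm_eq_norm[symmetric] frob_norm_def transpose_def)
qed

lemma norm_matrix_mult_right_le: "norm ((M::real^'n^'m) ** A) \<le> norm M * spec_norm A"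
proof -
  have rows: "(M ** A) $ i = transpose A *v (M $ i)" for i
    by (simp add: vec_eq_iff matrix_matrix_mult_def matrix_vector_mult_def transpose_def mult.commute)
  have "norm (transpose A *v x) \<le> spec_norm A * norm x" for x
    by (metis norm_matrix_vector_mult_le spec_norm_transpose)
  then have "norm (M ** A) \<le> L2_set (\<lambda>i. spec_norm A * norm (M $ i)) UNIV"
    unfolding norm_vec_def[of "M ** A"] rows
    by (intro L2_set_mono) simp_all
  also have "\<dots> = spec_norm A * norm M"
    by (simp add: norm_vec_def[of M] L2_set_right_distrib spec_norm_nonneg)
  finally show ?thesis
    by (simp add: mult.commute)
qed

lemma norm_matrix_mult_left_le: "norm (A ** (M::real^'m^'n)) \<le> spec_norm A * norm M"
proof -
  have "norm (A ** M) = norm (transpose M ** transpose A)"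
    by (metis matrix_transpose_mul norm_transpose)
  also have "\<dots> \<le> norm M * spec_norm A"
    using norm_matrix_mult_right_le[of "transpose M" "transpose A"]
    by (simp add: norm_transpose spec_norm_transpose)
  finally show ?thesis
    by (simp add: mult.commute)
qed

lemma norm_sandwich_le: "norm (A ** E ** B) \<le> spec_norm A * norm E * spec_norm B"
proof -
  have "norm (A ** E ** B) \<le> norm (A ** E) * spec_norm B"
    by (rule norm_matrix_mult_right_le)
  also have "\<dots> \<le> spec_norm A * norm E * spec_norm B"
    by (simp add: mult_right_mono norm_matrix_mult_left_le spec_norm_nonneg)
  finally show ?thesis .
qed

lemma mprod_Suc: "lo \<le> Suc hi \<Longrightarrow> mprod W (Suc hi) lo = W (Suc hi) ** mprod W hi lo"
  by (simp add: mprod_def)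

lemma spec_norm_mprod_le:
  assumes "\<And>l. lo \<le> l \<Longrightarrow> l \<le> hi \<Longrightarrow> spec_norm (W l) \<le> c"
  shows "spec_norm (mprod W hi lo) \<le> c ^ (Suc hi - lo)"
  using assms
proof (induction hi)
  case 0
  show ?case
  proof (cases lo)
    case 0
    then show ?thesis
      using "0.prems"[of 0] by (simp add: mprod_def)
  next
    case (Suc k)
    then show ?thesis
      by (simp add: mprod_def spec_norm_mat_1_le)
  qed
next
  case (Suc hi)
  show ?case
  proof (cases "lo \<le> Suc hi")
    case True
    have "spec_norm (mprod W (Suc hi) lo) \<le> spec_norm (W (Suc hi)) * spec_norm (mprod W hi lo)"
      using True by (simp add: mprod_Suc spec_norm_matrix_mult_le)
    also have "\<dots> \<le> c * c ^ (Suc hi - lo)"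
      using Suc True order_trans[OF spec_norm_nonneg "Suc.prems"[of "Suc hi"]]
      by (intro mult_mono spec_norm_nonneg) simp_all
    finally show ?thesis
      using True by (simp add: Suc_diff_le)
  next
    case False
    then show ?thesis
      by (simp add: mprod_def spec_norm_mat_1_le)
  qed
qed

lemma spec_norm_mprod_prefix_le:
  assumes "\<And>l. 1 \<le> l \<Longrightarrow> l \<le> L - 1 \<Longrightarrow> spec_norm (W l) \<le> \<alpha>" and "l \<le> L"
  shows "spec_norm (mprod W (l-1) 1) \<le> \<alpha> ^ (l-1)"
  using spec_norm_mprod_le[of 1 "l-1" W \<alpha>] assms by fastforce

lemma spec_norm_mprod_suffix_le:
  assumes "\<And>l. 1 \<le> l \<Longrightarrow> l \<le> L - 1 \<Longrightarrow> spec_norm (W l) \<le> \<alpha>"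
    and "spec_norm (W L) \<le> \<beta>" and "1 \<le> l" and "l < L"
  shows "spec_norm (mprod W L (l+1)) \<le> \<beta> * \<alpha> ^ (L-1-l)"
proof -
  have "mprod W L (l+1) = W L ** mprod W (L-1) (l+1)"
    using mprod_Suc[of "l+1" "L-1" W] assms(4) by simp
  then have "spec_norm (mprod W L (l+1)) \<le> spec_norm (W L) * spec_norm (mprod W (L-1) (l+1))"
    by (simp add: spec_norm_matrix_mult_le)
  also have "\<dots> \<le> \<beta> * \<alpha> ^ (L-1-l)"
    using spec_norm_mprod_le[of "l+1" "L-1" W \<alpha>] assms order_trans[OF spec_norm_nonneg assms(2)]
    by (intro mult_mono spec_norm_nonneg) (simp_all add: Suc_diff_Suc)
  finally show ?thesis .
qed

lemma frob_norm_grad_squared_le: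
  assumes "spec_norm (mprod W L (l+1)) \<le> p" and "spec_norm (mprod W (l-1) 1) \<le> q"
  shows "frob_norm (grad W Phi L l) ^ 2 \<le> 2 * (p * q) ^ 2 * risk W Phi L"
proof -
  let ?E = "mprod W L 1 - Phi"
  have "frob_norm (grad W Phi L l)
      \<le> spec_norm (mprod W L (l+1)) * norm ?E * spec_norm (mprod W (l-1) 1)"
    using norm_sandwich_le[of "transpose (mprod W L (l+1))" ?E "transpose (mprod W (l-1) 1)"]
    by (simp add: grad_def frob_norm_eq_norm spec_norm_transpose)
  also have "\<dots> \<le> p * norm ?E * q"
    using assms order_trans[OF spec_norm_nonneg assms(1)]
    by (intro mult_mono mult_right_mono) (simp_all add: spec_norm_nonneg)
  finally have "frob_norm (grad W Phi L l) ^ 2 \<le> (p * norm ?E * q) ^ 2"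
    by (rule power_mono) (simp add: frob_norm_eq_norm)
  then show ?thesis
    by (simp add: risk_def frob_norm_eq_norm power_mult_distrib mult_ac)
qed

lemma frob_norm_grad_inner_squared_le:
  assumes "\<And>l. 1 \<le> l \<Longrightarrow> l \<le> L - 1 \<Longrightarrow> spec_norm (W l) \<le> \<alpha>"
    and "spec_norm (W L) \<le> \<beta>" and "1 \<le> l" and "l < L"
  shows "frob_norm (grad W Phi L l) ^ 2 \<le> 2 * (\<alpha> ^ (2*(L-2)) * \<beta>^2) * risk W Phi L"
proof -
  have "frob_norm (grad W Phi L l) ^ 2 \<le> 2 * (\<beta> * \<alpha> ^ (L-1-l) * \<alpha> ^ (l-1)) ^ 2 * risk W Phi L"
    using assms(4) by (intro frob_norm_grad_squared_le
        spec_norm_mprod_suffix_le[where W = W and L = L, OF assms(1-3)]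
        spec_norm_mprod_prefix_le[where W = W and L = L, OF assms(1)]) simp_all
  moreover have "L-1-l + (l-1) = L-2"
    using assms(3,4) by simp
  ultimately show ?thesis
    by (simp add: power_mult_distrib power_even_eq mult_ac flip: power_add)
qed

lemma frob_norm_grad_last_squared_le:
  assumes "\<And>l. 1 \<le> l \<Longrightarrow> l \<le> L - 1 \<Longrightarrow> spec_norm (W l) \<le> \<alpha>"
  shows "frob_norm (grad W Phi L L) ^ 2 \<le> 2 * \<alpha> ^ (2*(L-1)) * risk W Phi L"
proof -
  have "frob_norm (grad W Phi L L) ^ 2 \<le> 2 * (1 * \<alpha> ^ (L-1)) ^ 2 * risk W Phi L"
    by (intro frob_norm_grad_squared_le spec_norm_mprod_prefix_le[where W = W and L = L, OF assms])
       (simp_all add: mprod_def spec_norm_mat_1_le)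
  then show ?thesis
    by (simp add: power_even_eq)
qed

theorem lemma8:
  fixes W :: "nat \<Rightarrow> real^'n^'n" and Phi :: "real^'n^'n"
    and L :: nat and \<alpha> \<beta> \<phi> :: real
  assumes "L \<ge> 2"
    and "\<And>l. 1 \<le> l \<Longrightarrow> l \<le> L - 1 \<Longrightarrow> spec_norm (W l) \<le> \<alpha>"
    and "spec_norm (W L) \<le> \<beta>"
    and "\<alpha> \<ge> 0" and "\<beta> \<ge> 0" and "\<phi> > 0"
    and "1 \<le> \<alpha> ^ (2*(L-1))" and "\<alpha> ^ (2*(L-1)) < real L * \<phi>^2"
    and "\<alpha> ^ (2*(L-1)) * \<beta>^2 < 2 * \<phi>^2"
  shows "(\<forall>l. 1 \<le> l \<and> l \<le> L - 1 \<longrightarrow> (frob_norm (grad W Phi L l))^2 \<le> 4 * \<phi>^2 * risk W Phi L)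
       \<and> (frob_norm (grad W Phi L L))^2 \<le> 2 * real L * \<phi>^2 * risk W Phi L"
proof -
  have risk_nonneg: "0 \<le> risk W Phi L"
    by (simp add: risk_def)
  have "1 \<le> \<alpha>"
    using assms(1,4,7) power_less_one_iff[of \<alpha> "2*(L-1)"] by linarith
  then have "\<alpha> ^ (2*(L-2)) * \<beta>^2 \<le> \<alpha> ^ (2*(L-1)) * \<beta>^2"
    by (intro mult_right_mono power_increasing) auto
  then have inner_factor: "2 * (\<alpha> ^ (2*(L-2)) * \<beta>^2) * risk W Phi L \<le> 4 * \<phi>^2 * risk W Phi L"
    using assms(9) risk_nonneg by (intro mult_right_mono) linarith+
  have last_factor: "2 * \<alpha> ^ (2*(L-1)) * risk W Phi L \<le> 2 * real L * \<phi>^2 * risk W Phi L"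
    using assms(8) risk_nonneg by (intro mult_right_mono) linarith+
  show ?thesis
  proof (intro conjI allI impI)
    fix l
    assume "1 \<le> l \<and> l \<le> L - 1"
    then have "1 \<le> l" and "l < L"
      using assms(1) by auto
    then show "frob_norm (grad W Phi L l) ^ 2 \<le> 4 * \<phi>^2 * risk W Phi L"
      using frob_norm_grad_inner_squared_le[where W = W and L = L, OF assms(2,3)] inner_factor
      by (blast intro: order_trans)
  next
    show "frob_norm (grad W Phi L L) ^ 2 \<le> 2 * real L * \<phi>^2 * risk W Phi L"
      using frob_norm_grad_last_squared_le[where W = W and L = L, OF assms(2)] last_factor
      by (rule order_trans)
  qed
qed

end
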